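(* Let $\pi$ be a permutation that avoids $231$, and let $k=2^{|\pi|+1}$. Then for every $n$ and every input sequence $X\in[0,1]^n$ that avoids both $231$ and $\pi$, we have $\mathrm{OPT}_k(X)\le 2^{|\pi|+2}$.
   Context: Two real sequences $(x_1,\dots,x_m)$ and $(y_1,\dots,y_m)$ are order-isomorphic if $x_i<x_j \iff y_i<y_j$ for all $i,j$. A sequence $X$ contains a sequence $Y$ if some (not necessarily contiguous) subsequence of $X$ is order-isomorphic to $Y$; otherwise $X$ avoids $Y$. $231$ denotes the permutation $(2,3,1)$; $|\pi|$ is the length of $\pi$. $k$-server on the line: given requests $X=(x_1,\dots,x_n)\in[0,1]^n$ and $k$ servers, let $p_i^j\in[0,1]$ be the position of server $j$ after serving request $i$, with $p_0^j=0$ for all $j$. The positions are a valid solution if for each $i\in[n]$ some $j$ has $p_i^j=x_i$. The cost is $\sum_{i\in[n]}\sum_{j\in[k]}|p_i^j-p_{i-1}^j|$, and $\mathrm{OPT}_k(X)$ is the minimum cost of a valid solution. *)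

theory Defs
  imports
    "HOL-Analysis.Analysis"
    "HOL-Library.Sublist"
    "HOL-Combinatorics.Multiset_Permutations"
begin

(* The entry types are independent so that real request sequences can be compared
   with permutations, which are lists of natural numbers. *)
definition order_isomorphic :: "'a::linorder list \<Rightarrow> 'b::linorder list \<Rightarrow> bool" where
  "order_isomorphic xs ys \<longleftrightarrow>
     length xs = length ys \<and>
     (\<forall>i<length xs. \<forall>j<length xs. xs ! i < xs ! j \<longleftrightarrow> ys ! i < ys ! j)"

definition contains :: "'a::linorder list \<Rightarrow> 'b::linorder list \<Rightarrow> bool" where
  "contains X Y \<longleftrightarrow> (\<exists>Z. subseq Z X \<and> order_isomorphic Z Y)"

abbreviation avoids :: "'a::linorder list \<Rightarrow> 'b::linorder list \<Rightarrow> bool" where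
  "avoids X Y \<equiv> \<not> contains X Y"

definition perm231 :: "nat list" where
  "perm231 = [2, 3, 1]"

(* p i j is the position of server j (0 \<le> j < k) after serving request i, time 0 being
   the start.  Requests are numbered from 1, so request i is X ! (i - 1).  Values of p
   outside these index ranges are unconstrained and never used. *)
definition valid_solution :: "nat \<Rightarrow> real list \<Rightarrow> (nat \<Rightarrow> nat \<Rightarrow> real) \<Rightarrow> bool" where
  "valid_solution k X p \<longleftrightarrow>
     (\<forall>j<k. p 0 j = 0) \<and>
     (\<forall>i\<le>length X. \<forall>j<k. p i j \<in> {0..1}) \<and>
     (\<forall>i\<in>{1..length X}. \<exists>j<k. p i j = X ! (i - 1))"

definition solution_cost :: "nat \<Rightarrow> real list \<Rightarrow> (nat \<Rightarrow> nat \<Rightarrow> real) \<Rightarrow> real" where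
  "solution_cost k X p = (\<Sum>i = 1..length X. \<Sum>j<k. \<bar>p i j - p (i - 1) j\<bar>)"

(* Written as an infimum; OPT_attained below shows that it is a minimum. *)
definition OPT :: "nat \<Rightarrow> real list \<Rightarrow> real" where
  "OPT k X = (INF p \<in> {p. valid_solution k X p}. solution_cost k X p)"

lemma solution_cost_nonneg: "solution_cost k X p \<ge> 0"
  unfolding solution_cost_def by (intro sum_nonneg) auto

lemma OPT_le: "valid_solution k X p \<Longrightarrow> OPT k X \<le> solution_cost k X p"
  unfolding OPT_def
  by (rule cINF_lower) (auto intro!: bdd_belowI[where m = 0] solution_cost_nonneg)

lemma compact_positions: "compact {p :: nat \<Rightarrow> nat \<Rightarrow> real. \<forall>i j. p i j \<in> {0..1}}"
proof -
  have 1: "compact {q :: nat \<Rightarrow> real. \<forall>j. q j \<in> {0..1}}"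
    using compactin_PiE[of "\<lambda>_::nat. euclidean :: real topology" UNIV "\<lambda>_. {0..1}"]
    by (simp add: euclidean_product_topology PiE_UNIV_domain Pi_def)
  have "compact {p :: nat \<Rightarrow> nat \<Rightarrow> real. \<forall>i. p i \<in> {q. \<forall>j. q j \<in> {0..1}}}"
    using compactin_PiE[of "\<lambda>_::nat. euclidean :: (nat \<Rightarrow> real) topology" UNIV
        "\<lambda>_. {q. \<forall>j. q j \<in> {0..1}}"] 1
    by (simp add: euclidean_product_topology PiE_UNIV_domain Pi_def)
  then show ?thesis by simp
qed

lemma continuous_position: "continuous_on S (\<lambda>p :: nat \<Rightarrow> nat \<Rightarrow> real. p i j)"
  by (rule continuous_on_product_then_coordinatewise[OF
        continuous_on_product_then_coordinatewise[OF continuous_on_id]])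

lemma OPT_attained:
  assumes "k \<ge> 1" and "set X \<subseteq> {0..1}"
  obtains p where "valid_solution k X p" and "solution_cost k X p = OPT k X"
proof -
  let ?B = "{p :: nat \<Rightarrow> nat \<Rightarrow> real. \<forall>i j. p i j \<in> {0..1}}"
  let ?V = "(\<Inter>j\<in>{..<k}. {p :: nat \<Rightarrow> nat \<Rightarrow> real. p 0 j = 0}) \<inter>
            (\<Inter>i\<in>{1..length X}. \<Union>j\<in>{..<k}. {p. p i j = X ! (i - 1)})"
  define S where "S = ?B \<inter> ?V"
  have "closed ?V"
    by (intro closed_Int closed_INT closed_UN ballI closed_Collect_eq
        continuous_position continuous_on_const) auto
  then have comp: "compact S"
    unfolding S_def using compact_positions by (rule compact_Int_closed[rotated])
  have "\<exists>j. j < k"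
    using assms(1) by (intro exI[of _ 0]) simp
  have "X ! (i - 1) \<in> {0..1}" if "i \<in> {1..length X}" for i
  proof (rule subsetD[OF assms(2)])
    show "X ! (i - 1) \<in> set X" using that by (intro nth_mem) auto
  qed
  then have "(\<lambda>i j. if i \<in> {1..length X} then X ! (i - 1) else 0) \<in> S"
    using \<open>\<exists>j. j < k\<close> by (auto simp: S_def)
  then have ne: "S \<noteq> {}" by blast
  have "continuous_on S (solution_cost k X)"
    unfolding solution_cost_def[abs_def]
    by (intro continuous_on_sum continuous_on_rabs continuous_on_diff continuous_position)
  from continuous_attains_inf[OF comp ne this] obtain p where
    p: "p \<in> S" and
    min: "\<And>q. q \<in> S \<Longrightarrow> solution_cost k X p \<le> solution_cost k X q"
    by blast
  have v: "valid_solution k X p"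
    using p by (auto simp: S_def valid_solution_def)
  have "solution_cost k X p \<le> solution_cost k X q" if q: "valid_solution k X q" for q
  proof -
    let ?q = "\<lambda>i j. if i \<le> length X \<and> j < k then q i j else 0"
    have "?q \<in> S" using q by (auto simp: S_def valid_solution_def)
    moreover have "solution_cost k X ?q = solution_cost k X q"
      unfolding solution_cost_def by (intro sum.cong) auto
    ultimately show ?thesis using min[of ?q] by simp
  qed
  then have "solution_cost k X p \<le> OPT k X"
    unfolding OPT_def using v by (intro cINF_greatest) auto
  with OPT_le[OF v] have "solution_cost k X p = OPT k X" by (rule antisym[rotated])
  with v show thesis by (rule that)
qed

end

theory Submission
  imports Defs
begin

text \<open>
  A sequence avoiding 231 has the form \<open>y # R @ Q\<close> with \<open>R \<le> y \<le> Q\<close>, so the blocks between its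
  left-to-right maxima occupy consecutive intervals. Write \<open>\<pi> = L @ t # R\<close> with \<open>t\<close> the maximum, so
  that \<open>L < R\<close>. The first block completing a copy of \<open>L\<close> splits the input into a part on the left
  avoiding \<open>L\<close>, then that block (its maximum \<open>m\<close> followed by a sequence avoiding \<open>\<pi>\<close>), then blocks on
  the right whose interiors avoid \<open>R\<close>. Iterating inside the middle block gives nested intervals
  whose left parts are requested from left to right, and after all of them the right parts, again
  from left to right. Hence one group of servers for \<open>L\<close> and one group for \<open>R\<close> each sweep the
  interval only once; two more servers take care of the block maxima and of repeated values. By
  induction \<open>2 |\<pi>|\<close> servers of total cost \<open>4 |\<pi>|\<close> suffice.
\<close>

section \<open>Pattern containment\<close>

lemma contains_subseq: "contains Y Z \<Longrightarrow> subseq Y X \<Longrightarrow> contains X Z"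
  unfolding contains_def by (meson subseq_order.order_trans)

lemma contains_Nil [simp]: "contains X []"
  unfolding contains_def order_isomorphic_def by (intro exI[of _ "[]"]) simp

lemma avoids_231D:
  assumes "avoids X perm231" "subseq [x, y, z] X" "z < x" "x < y"
  shows False
proof -
  have "order_isomorphic [x, y, z] perm231"
    using assms(3,4) unfolding order_isomorphic_def perm231_def
    by (auto simp: less_Suc_eq numeral_3_eq_3)
  with assms(1,2) show False unfolding contains_def by blast
qed

lemma order_isomorphic_append:
  assumes "order_isomorphic A C" "order_isomorphic B D"
    and "\<And>a b. a \<in> set A \<Longrightarrow> b \<in> set B \<Longrightarrow> a < b"
    and "\<And>c d. c \<in> set C \<Longrightarrow> d \<in> set D \<Longrightarrow> c < d"
  shows "order_isomorphic (A @ B) (C @ D)"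
proof -
  have l: "length C = length A" "length D = length B"
    using assms(1,2) by (auto simp: order_isomorphic_def)
  have "(A @ B) ! i < (A @ B) ! j \<longleftrightarrow> (C @ D) ! i < (C @ D) ! j"
    if ij: "i < length (A @ B)" "j < length (A @ B)" for i j
  proof (cases "i < length A"; cases "j < length A")
    assume "i < length A" "j < length A"
    then show ?thesis using assms(1) l by (auto simp: order_isomorphic_def nth_append)
  next
    assume *: "i < length A" "\<not> j < length A"
    then have "A ! i < B ! (j - length A)" "C ! i < D ! (j - length A)"
      using ij l by (auto intro!: assms(3,4))
    then show ?thesis using * l by (simp add: nth_append)
  next
    assume *: "\<not> i < length A" "j < length A"
    then have "A ! j < B ! (i - length A)" "C ! j < D ! (i - length A)"
      using ij l by (auto intro!: assms(3,4))
    then show ?thesis using * l by (auto simp add: nth_append)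
  next
    assume "\<not> i < length A" "\<not> j < length A"
    then show ?thesis using assms(2) l ij by (auto simp: order_isomorphic_def nth_append)
  qed
  with l show ?thesis by (simp add: order_isomorphic_def)
qed

lemma order_isomorphic_Cons_max:
  assumes "order_isomorphic Z R" "\<And>v. v \<in> set Z \<Longrightarrow> v < z" "\<And>v. v \<in> set R \<Longrightarrow> v < t"
  shows "order_isomorphic (z # Z) (t # R)"
proof -
  have l: "length R = length Z"
    using assms(1) by (auto simp: order_isomorphic_def)
  have "Z ! i < z" "R ! i < t" if "i < length Z" for i
    using that l by (auto intro!: assms(2,3))
  then have "(z # Z) ! i < (z # Z) ! j \<longleftrightarrow> (t # R) ! i < (t # R) ! j"
    if "i < length (z # Z)" "j < length (z # Z)" for i j
    using that assms(1) l by (cases i; cases j) (force simp: order_isomorphic_def dest: order.asym)+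
  with l show ?thesis by (simp add: order_isomorphic_def)
qed

section \<open>Splitting 231-avoiding sequences\<close>

lemma split_231:
  fixes y :: real
  assumes "avoids (y # X) perm231"
  obtains R Q where "X = R @ Q" "\<forall>v\<in>set R. v \<le> y" "\<forall>v\<in>set Q. y \<le> v"
proof
  let ?Q = "dropWhile (\<lambda>v. v \<le> y) X"
  show "X = takeWhile (\<lambda>v. v \<le> y) X @ ?Q" by simp
  show "\<forall>v\<in>set (takeWhile (\<lambda>v. v \<le> y) X). v \<le> y" by (auto dest: set_takeWhileD)
  \<comment> \<open>The first entry \<open>q\<close> of \<open>?Q\<close> exceeds \<open>y\<close>,
    so a later entry \<open>v\<close> below \<open>y\<close> would complete the 231 pattern
    \<open>y\<close>, \<open>q\<close>, \<open>v\<close>.\<close>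
  show "\<forall>v\<in>set ?Q. y \<le> v"
  proof (cases ?Q)
    case (Cons q Q)
    then have q: "y < q" using hd_dropWhile[of "\<lambda>v. v \<le> y" X] by auto
    have sub: "subseq (q # Q) X"
      by (metis Cons takeWhile_dropWhile_id list_emb_append2 subseq_order.refl)
    have "y \<le> v" if v: "v \<in> set Q" for v
    proof (rule ccontr)
      assume "\<not> y \<le> v"
      moreover have "subseq [v] Q" using v by (simp add: subseq_singleton_left)
      then have "subseq [q, v] X" using sub by (meson subseq_Cons2 subseq_order.order_trans)
      then have "subseq [y, q, v] (y # X)" by simp
      ultimately show False using avoids_231D[OF assms, of y q v] q by linarith
    qed
    then show ?thesis using Cons q by auto
  next
    case Nil
    then show ?thesis unfolding Nil by simp
  qed
qed

text \<open>An entry of \<open>L\<close> above an entry of \<open>R\<close> would form a 231 with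
  the maximum \<open>t\<close> between them; distinctness makes all inequalities strict.\<close>

lemma split_max:
  fixes \<pi> :: "nat list"
  assumes "\<pi> \<noteq> []" "distinct \<pi>" "avoids \<pi> perm231"
  obtains L t R where "\<pi> = L @ t # R" "\<forall>v\<in>set L. v < t" "\<forall>v\<in>set R. v < t"
    "\<forall>v\<in>set L. \<forall>w\<in>set R. v < w"
proof -
  define t where "t = Max (set \<pi>)"
  have "t \<in> set \<pi>" using assms(1) by (simp add: t_def)
  then obtain L R where p: "\<pi> = L @ t # R" by (meson split_list)
  have lt: "v < t" if "v \<in> set L \<union> set R" for v
  proof -
    have "v \<in> set \<pi>" using that by (auto simp: p)
    then have "v \<le> t" by (simp add: t_def)
    moreover have "v \<noteq> t" using assms(2) that p by auto
    ultimately show ?thesis by simp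
  qed
  have "v < w" if v: "v \<in> set L" and w: "w \<in> set R" for v w
  proof (rule ccontr)
    assume "\<not> v < w"
    moreover have "v \<noteq> w" using assms(2) v w p by auto
    ultimately have "w < v" by simp
    moreover have "subseq ([v] @ [t, w]) (L @ t # R)"
      using v w by (intro list_emb_append_mono) (auto simp: subseq_singleton_left)
    then have "subseq [v, t, w] \<pi>" using p by simp
    ultimately show False using avoids_231D[OF assms(3)] lt v by auto
  qed
  with p lt show ?thesis by (intro that) auto
qed

text \<open>Blocks of \<open>X\<close>, each a left-to-right maximum with the entries up to the next
  one, are moved to the end of \<open>P\<close> until the next block completes a copy of
  \<open>L\<close>; \<open>c\<close> separates \<open>P\<close> from what remains. The alternative
  \<open>P = []\<close> is needed for \<open>L = []\<close>, which no list avoids.\<close>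

lemma split_at_completion:
  fixes L :: "nat list" and X :: "real list"
  assumes "X \<noteq> []" "avoids X perm231" "set X \<subseteq> {c..b}"
    and "set P \<subseteq> {a..c}" "a \<le> c" "P = [] \<or> avoids P L" "contains (P @ X) L"
  shows "\<exists>P' c' m R Q. P @ X = P' @ m # R @ Q \<and> set P' \<subseteq> {a..c'} \<and> set R \<subseteq> {c'..m} \<and>
    set Q \<subseteq> {m..b} \<and> a \<le> c' \<and> c' \<le> m \<and> m \<le> b \<and> (P' = [] \<or> avoids P' L) \<and>
    contains (P' @ m # R) L"
  using assms
proof (induction "length X" arbitrary: P X c rule: less_induct)
  case less
  obtain y X' where X: "X = y # X'" using less.prems(1) by (cases X) auto
  obtain R Q where Q: "X' = R @ Q" "\<forall>v\<in>set R. v \<le> y" "\<forall>v\<in>set Q. y \<le> v"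
    using split_231 less.prems(2) X by metis
  show ?case
  proof (cases "contains (P @ y # R) L")
    case True
    then show ?thesis
      using less.prems X Q by (intro exI[of _ P] exI[of _ c] exI[of _ y] exI[of _ R] exI[of _ Q]) auto
  next
    case False
    then have "Q \<noteq> []" using less.prems(7) X Q by auto
    moreover have "subseq Q X" using X Q by (metis append_Cons list_emb_append2 subseq_order.refl)
    then have "avoids Q perm231" using less.prems(2) contains_subseq by blast
    moreover have "set Q \<subseteq> {y..b}" "set (P @ y # R) \<subseteq> {a..y}" "a \<le> y" "length Q < length X"
      using less.prems X Q by auto
    ultimately show ?thesis
      using less.hyps[of Q y "P @ y # R"] False less.prems(7) X Q by simp
  qed
qed

section \<open>Schedules\<close>

text \<open>\<open>C\<close> is only an upper bound on the cost, and the multisets \<open>M\<close> and \<open>N\<close> hold the initial and final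
  positions of interchangeable servers.\<close>

inductive serves :: "real multiset \<Rightarrow> real list \<Rightarrow> real multiset \<Rightarrow> real \<Rightarrow> bool" where
  stop: "0 \<le> C \<Longrightarrow> serves M [] M C"
| move: "serves (add_mset y M) X N C \<Longrightarrow> serves (add_mset x M) X N (\<bar>x - y\<bar> + C)"
| serve: "serves (add_mset x M) X N C \<Longrightarrow> serves (add_mset x M) (x # X) N C"

section \<open>Composing schedules\<close>

lemma serves_mono: "serves M X N C \<Longrightarrow> C \<le> D \<Longrightarrow> serves M X N D"
proof (induction arbitrary: D rule: serves.induct)
  case (move y M X N C x)
  then have "serves (add_mset y M) X N (D - \<bar>x - y\<bar>)" by simp
  then show ?case using serves.move[of y M X N "D - \<bar>x - y\<bar>" x] by simp
qed (auto intro: serves.intros)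

lemma serves_append:
  "serves M X N C \<Longrightarrow> serves N Y K D \<Longrightarrow> serves M (X @ Y) K (C + D)"
proof (induction rule: serves.induct)
  case (stop C M)
  then show ?case by (auto intro: serves_mono)
next
  case (move y M X N C x)
  then show ?case using serves.move[of y M "X @ Y" K "C + D" x] by (simp add: add.assoc)
qed (auto intro: serves.intros)

lemma serves_frame: "serves M X N C \<Longrightarrow> serves (M + F) X (N + F) C"
  by (induction rule: serves.induct) (auto intro: serves.intros)

lemma serves_request: "x \<in># M \<Longrightarrow> serves M X N C \<Longrightarrow> serves M (x # X) N C"
  by (metis insert_DiffM serves.serve)

text \<open>The servers in \<open>F\<close> never move and answer every request at their positions
  for free, so the others see only the filtered sequence.\<close>

lemma serves_by_standing:
  assumes "serves M (filter (\<lambda>x. x \<notin># F) X) N C"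
  shows "serves (M + F) X (N + F) C"
proof -
  \<comment> \<open>The filtered list is named \<open>Y\<close> so that rule induction applies; in
    each case the requests answered by \<open>F\<close> are put back in front of the next
    one.\<close>
  have "serves M Y N C \<Longrightarrow> Y = filter (\<lambda>x. x \<notin># F) X \<Longrightarrow> serves (M + F) X (N + F) C" for Y
  proof (induction arbitrary: X rule: serves.induct)
    case (stop C M)
    then show ?case
    proof (induction X)
      case (Cons x X)
      then show ?case by (intro serves_request) (auto split: if_splits)
    qed (auto intro: serves.intros)
  next
    case (move y M Y N C x)
    then show ?case by (auto intro: serves.intros)
  next
    case (serve x M Y N C)
    from serve.prems show ?case
    proof (induction X)
      case (Cons z X)
      show ?case
      proof (cases "z \<in># F")
        case True
        then show ?thesis using Cons by (intro serves_request) auto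
      next
        case False
        then show ?thesis using Cons.prems serve.IH[of X] by (intro serves_request) auto
      qed
    qed simp
  qed
  with assms show ?thesis by blast
qed

lemma replicate_mset_add: "replicate_mset (m + n) x = replicate_mset m x + replicate_mset n x"
  by (induction m) auto

lemma serves_shift:
  "serves (replicate_mset n x) [] (replicate_mset n y) (n * \<bar>x - y\<bar>)"
proof (induction n)
  case (Suc n)
  have "serves (add_mset y (replicate_mset n x)) [] (add_mset y (replicate_mset n y)) (n * \<bar>x - y\<bar>)"
    using serves_frame[OF Suc, of "{#y#}"] by simp
  from serves.move[OF this, of x] show ?case by (simp add: algebra_simps)
qed (auto intro: serves.intros)

text \<open>The servers in \<open>M'\<close> wait until all of \<open>X\<close> is served and move
  only then.\<close>

lemma serves_parallel:
  assumes "serves M X N C" "serves M' [] N' D"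
  shows "serves (M + M') X (N + N') (C + D)"
proof -
  have "serves (N + M') [] (N + N') D"
    using serves_frame[OF assms(2), of N] by (simp add: add.commute)
  from serves_append[OF serves_frame[OF assms(1)] this] show ?thesis by simp
qed

section \<open>From schedules to the optimal cost\<close>

lemma solution_cost_first:
  assumes "length X > 0"
  shows "solution_cost k X p = (\<Sum>j<k. \<bar>p 1 j - p 0 j\<bar>) +
    (\<Sum>i = 2..length X. \<Sum>j<k. \<bar>p i j - p (i - 1) j\<bar>)"
proof -
  have "{1..length X} = insert 1 {2..length X}" using assms by (auto simp: Suc_le_eq)
  then show ?thesis by (simp add: solution_cost_def)
qed

text \<open>Servers regain their names: \<open>p0\<close> is an arbitrary labelling of
  \<open>M\<close>, and a move from \<open>x\<close> is assigned to any index \<open>j\<close> with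
  \<open>p0 j = x\<close>.\<close>

lemma serves_trajectory:
  assumes "serves M X N C" "image_mset p0 (mset_set {..<k}) = M"
  shows "\<exists>p. p 0 = p0 \<and> (\<forall>i\<in>{1..length X}. \<exists>j<k. p i j = X ! (i - 1)) \<and>
    solution_cost k X p \<le> C"
  using assms
proof (induction arbitrary: p0 rule: serves.induct)
  case (stop C M)
  then show ?case by (intro exI[of _ "\<lambda>_. p0"]) (simp add: solution_cost_def)
next
  case (move y M X N C x)
  have "x \<in># image_mset p0 (mset_set {..<k})" using move.prems by simp
  then obtain j where j: "j < k" "p0 j = x" by auto
  have k: "mset_set {..<k} = add_mset j (mset_set ({..<k} - {j}))"
    using j(1) by (metis finite_lessThan lessThan_iff mset_set.remove)
  have M: "M = image_mset p0 (mset_set ({..<k} - {j}))"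
    using move.prems j unfolding k by simp
  have "image_mset (p0(j := y)) (mset_set {..<k}) = add_mset y M"
    unfolding k M by (auto intro!: image_mset_cong)
  from move.IH[OF this] obtain p where p: "p 0 = p0(j := y)"
    "\<forall>i\<in>{1..length X}. \<exists>j<k. p i j = X ! (i - 1)" "solution_cost k X p \<le> C" by blast
  define q where "q = p(0 := p0)"
  \<comment> \<open>Several moves may precede a request, whereas \<open>p\<close> records one
    transition per request. Starting from \<open>p0\<close> merges this move into the first
    transition, and the triangle inequality for server \<open>j\<close> bounds the increase. With no
    request left, both costs are 0.\<close>
  have "solution_cost k X q \<le> \<bar>x - y\<bar> + solution_cost k X p"
  proof (cases "length X")
    case (Suc n)
    have first: "(\<Sum>l<k. \<bar>p 1 l - p0 l\<bar>) \<le> \<bar>x - y\<bar> + (\<Sum>l<k. \<bar>p 1 l - p 0 l\<bar>)"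
    proof -
      have "(\<Sum>l<k. \<bar>p 1 l - p0 l\<bar>) \<le> (\<Sum>l<k. (if l = j then \<bar>x - y\<bar> else 0) + \<bar>p 1 l - p 0 l\<bar>)"
        using j by (intro sum_mono) (auto simp: p(1))
      also have "\<dots> = \<bar>x - y\<bar> + (\<Sum>l<k. \<bar>p 1 l - p 0 l\<bar>)"
        using j(1) by (simp add: sum.distrib)
      finally show ?thesis .
    qed
    have "(\<Sum>i = 2..length X. \<Sum>l<k. \<bar>q i l - q (i - 1) l\<bar>) =
        (\<Sum>i = 2..length X. \<Sum>l<k. \<bar>p i l - p (i - 1) l\<bar>)"
      by (intro sum.cong) (auto simp: q_def)
    then have "solution_cost k X q = (\<Sum>l<k. \<bar>p 1 l - p0 l\<bar>) +
        (\<Sum>i = 2..length X. \<Sum>l<k. \<bar>p i l - p (i - 1) l\<bar>)"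
      using Suc by (subst solution_cost_first) (auto simp: q_def)
    then show ?thesis using first Suc by (simp add: solution_cost_first)
  qed (simp add: solution_cost_def)
  moreover have "\<forall>i\<in>{1..length X}. \<exists>j<k. q i j = X ! (i - 1)" "q 0 = p0"
    using p(2) by (auto simp: q_def)
  ultimately show ?case using p(3) by (intro exI[of _ q]) auto
next
  case (serve x M X N C)
  obtain p where p: "p 0 = p0" "\<forall>i\<in>{1..length X}. \<exists>j<k. p i j = X ! (i - 1)"
    "solution_cost k X p \<le> C" using serve.IH[OF serve.prems] by blast
  \<comment> \<open>Truncated subtraction gives \<open>q 0 = q 1 = p0\<close>: nothing moves for the
    request \<open>x\<close>, and the old solution follows one step later.\<close>
  define q where "q i = p (i - 1)" for i :: nat
  have "x \<in># image_mset p0 (mset_set {..<k})" using serve.prems by simp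
  then have x: "\<exists>j<k. p0 j = x" by auto
  have "\<exists>j<k. q i j = (x # X) ! (i - 1)" if "i \<in> {1..length (x # X)}" for i
  proof (cases "i = 1")
    case False
    with that have "i - 1 \<in> {1..length X}" by auto
    with p(2) obtain j where "j < k" "p (i - 1) j = X ! (i - 1 - 1)" by blast
    with False that show ?thesis by (auto simp: q_def nth_Cons')
  qed (use x p(1) in \<open>simp add: q_def\<close>)
  moreover have "solution_cost k (x # X) q = solution_cost k X p"
  proof -
    have "(\<Sum>i = 2..Suc (length X). \<Sum>l<k. \<bar>q i l - q (i - 1) l\<bar>) =
        (\<Sum>i = 1..length X. \<Sum>l<k. \<bar>q (Suc i) l - q (Suc i - 1) l\<bar>)"
      unfolding numeral_2_eq_2 One_nat_def by (rule sum.shift_bounds_cl_Suc_ivl)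
    also have "\<dots> = solution_cost k X p"
      unfolding solution_cost_def by (intro sum.cong) (auto simp: q_def)
    finally show ?thesis by (subst solution_cost_first) (auto simp: q_def)
  qed
  moreover have "q 0 = p0" using p(1) by (simp add: q_def)
  ultimately show ?case using p(3) by (intro exI[of _ q]) auto
qed

lemma OPT_le_serves:
  assumes "serves (replicate_mset k 0) X N C" "set X \<subseteq> {0..1}"
  shows "OPT k X \<le> C"
proof -
  have "image_mset (\<lambda>_. 0) (mset_set {..<k}) = replicate_mset k (0 :: real)"
    by (simp add: image_mset_const_eq)
  from serves_trajectory[OF assms(1) this] obtain p where
    p: "p 0 = (\<lambda>_. 0)" "\<forall>i\<in>{1..length X}. \<exists>j<k. p i j = X ! (i - 1)" "solution_cost k X p \<le> C"
    by blast
  \<comment> \<open>\<open>serves\<close> does not confine servers to the unit interval. Clamping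
    does, without increasing distances or displacing a server from a request.\<close>
  define q where "q i j = max 0 (min 1 (p i j))" for i j
  have "valid_solution k X q"
    unfolding valid_solution_def
  proof (intro conjI ballI)
    fix i assume i: "i \<in> {1..length X}"
    then obtain j where "j < k" "p i j = X ! (i - 1)" using p(2) by blast
    moreover have "X ! (i - 1) \<in> {0..1}"
      using i by (intro subsetD[OF assms(2)] nth_mem) auto
    ultimately show "\<exists>j<k. q i j = X ! (i - 1)" by (auto simp: q_def intro!: exI[of _ j])
  qed (auto simp: q_def p(1))
  then have "OPT k X \<le> solution_cost k X q" by (rule OPT_le)
  also have "\<dots> \<le> solution_cost k X p"
    unfolding solution_cost_def q_def by (intro sum_mono) (auto simp: max_def min_def)
  finally show ?thesis using p(3) by simp
qed

section \<open>Serving sequences that avoid a pattern\<close>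

text \<open>All servers pass from the left end of an arbitrary interval to its right end, so
  schedules on adjacent intervals can be chained at a cost proportional to the total length.\<close>

definition servable :: "nat list \<Rightarrow> bool" where
  "servable \<pi> \<longleftrightarrow> (\<forall>(a :: real) b X. a \<le> b \<longrightarrow> set X \<subseteq> {a..b} \<longrightarrow> avoids X perm231 \<longrightarrow> avoids X \<pi> \<longrightarrow>
     serves (replicate_mset (2 * length \<pi>) a) X (replicate_mset (2 * length \<pi>) b)
       (4 * length \<pi> * (b - a)))"

lemma servableD:
  fixes a b :: real
  assumes "servable \<pi>" "a \<le> b" "set X \<subseteq> {a..b}" "avoids X perm231" "avoids X \<pi>"
  shows "serves (replicate_mset (2 * length \<pi>) a) X (replicate_mset (2 * length \<pi>) b)
       (4 * length \<pi> * (b - a))"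
  using assms unfolding servable_def by blast

text \<open>One extra server stands on the current block maximum and one on the previous one, so that the
  servers for \<open>R\<close> only see requests strictly between the two.\<close>

lemma serves_right_blocks:
  fixes m b :: real
  assumes R: "servable R"
  assumes "set Q \<subseteq> {m..b}" "m \<le> b" "avoids Q perm231"
    and "\<And>z Z. subseq (z # Z) Q \<Longrightarrow> order_isomorphic Z R \<Longrightarrow> m < z \<Longrightarrow>
      \<forall>v\<in>set Z. m < v \<and> v < z \<Longrightarrow> False"
  shows "serves (replicate_mset (2 * length R + 2) m) Q (replicate_mset (2 * length R + 2) b)
    ((4 * length R + 2) * (b - m))"
  using assms(2-)
proof (induction "length Q" arbitrary: m Q rule: less_induct)
  case less
  let ?r = "length R"
  consider "Q = []" | Q' where "Q = m # Q'" | y Q' where "Q = y # Q'" "y \<noteq> m"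
    by (cases Q) auto
  then show ?case
  proof cases
    case 1
    have "real (2 * ?r + 2) * \<bar>m - b\<bar> \<le> (4 * ?r + 2) * (b - m)"
      using less.prems(2) by (simp add: mult_right_mono)
    then show ?thesis using serves_mono[OF serves_shift] 1 by blast
  next
    case (2 Q')
    have "subseq Q' Q" unfolding 2 by (rule list_emb_Cons) simp
    moreover from this have "avoids Q' perm231" using less.prems(3) contains_subseq by blast
    ultimately have "serves (replicate_mset (2 * ?r + 2) m) Q' (replicate_mset (2 * ?r + 2) b)
        ((4 * ?r + 2) * (b - m))"
      using less.prems(1,2) 2
      by (intro less.hyps) (auto intro: less.prems(4) subseq_order.order_trans)
    then show ?thesis unfolding 2 by (intro serves_request) auto
  next
    case Cons: (3 y Q')
    obtain B T where B: "Q' = B @ T" "\<forall>v\<in>set B. v \<le> y" "\<forall>v\<in>set T. y \<le> v"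
      using split_231 less.prems(3) Cons by metis
    \<comment> \<open>The last hypothesis only excludes copies of \<open>R\<close> lying strictly
      between \<open>m\<close> and a later \<open>z\<close>, hence requests equal to
      \<open>m\<close> or \<open>y\<close> are left to the two standing servers.\<close>
    define B' where "B' = filter (\<lambda>x. x \<notin># {#m, y#}) B"
    have y: "m < y" "y \<le> b" using less.prems(1) Cons by auto
    have sB: "subseq B' B" by (simp add: B'_def)
    have sB': "subseq (y # B') Q" using sB Cons B by (simp add: list_emb_prefix)
    have sT: "subseq T Q" using Cons B by (metis append_Cons list_emb_append2 subseq_order.refl)
    have B'_in: "\<forall>v\<in>set B'. m < v \<and> v < y"
      using less.prems(1) Cons B by (fastforce simp: B'_def)
    have "avoids B' perm231"
      using less.prems(3) sB' contains_subseq by (metis subseq_Cons')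
    moreover have "avoids B' R"
    proof
      assume "contains B' R"
      then obtain Z where Z: "subseq Z B'" "order_isomorphic Z R" unfolding contains_def by blast
      have "subseq (y # Z) Q" using Z(1) sB' by (meson subseq_Cons2 subseq_order.order_trans)
      moreover have "\<forall>v\<in>set Z. m < v \<and> v < y" using B'_in list_emb_set[OF Z(1)] by blast
      ultimately show False using less.prems(4) Z(2) y(1) by blast
    qed
    moreover have "set B' \<subseteq> {m..y}" using B'_in by auto
    ultimately have "serves (replicate_mset (2 * ?r) m) B' (replicate_mset (2 * ?r) y)
        (4 * ?r * (y - m))" using servableD[OF R less_imp_le[OF y(1)]] by blast
    then have "serves (replicate_mset (2 * ?r) m + {#m, y#}) B
        (replicate_mset (2 * ?r) y + {#m, y#}) (4 * ?r * (y - m))"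
      unfolding B'_def by (rule serves_by_standing)
    then have "serves (replicate_mset (2 * ?r) m + {#m, y#}) (y # B)
        (replicate_mset (2 * ?r) y + {#m, y#}) (4 * ?r * (y - m))"
      by (rule serves_request[rotated]) simp
    \<comment> \<open>One server goes ahead from \<open>m\<close> to \<open>y\<close>; the one left
      at \<open>m\<close> follows after the block. These two trips account for the 2 in
      \<open>4 * ?r + 2\<close>.\<close>
    then have 1: "serves (replicate_mset (2 * ?r + 2) m) (y # B)
        (replicate_mset (2 * ?r) y + {#m, y#}) (\<bar>m - y\<bar> + 4 * ?r * (y - m))"
      using serves.move[of y "replicate_mset (2 * ?r + 1) m"] by (simp add: add_mset_commute)
    have 2: "serves (replicate_mset (2 * ?r) y + {#m, y#}) []
        (replicate_mset (2 * ?r + 2) y) (\<bar>m - y\<bar> + 0)"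
      using serves.move[of y "replicate_mset (2 * ?r + 1) y" "[]" "replicate_mset (2 * ?r + 2) y" 0 m]
      by (simp add: serves.stop add_mset_commute)
    have 3: "serves (replicate_mset (2 * ?r + 2) y) T (replicate_mset (2 * ?r + 2) b)
        ((4 * ?r + 2) * (b - y))"
    proof (rule less.hyps)
      show "length T < length Q" "set T \<subseteq> {y..b}" "y \<le> b"
        using Cons B less.prems(1) y by auto
      show "avoids T perm231" using less.prems(3) sT contains_subseq by blast
      show False if "subseq (z # Z) T" "order_isomorphic Z R" "y < z" "\<forall>v\<in>set Z. y < v \<and> v < z" for z Z
        using less.prems(4)[of z Z] that sT y(1) by (meson less_trans subseq_order.order_trans)
    qed
    show ?thesis
      using serves_append[OF serves_append[OF 1 2] 3] Cons B y
      by (auto elim!: serves_mono simp: algebra_simps)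
  qed
qed

text \<open>The servers for \<open>R\<close> travel along with those for \<open>L\<close> until the innermost interval is reached, while one
  server descends through the right ends of the nested intervals.\<close>

lemma serves_nested:
  fixes a b :: real
  assumes L: "servable L" and R: "servable R"
    and L_lt: "\<forall>v\<in>set L. v < t" and R_lt: "\<forall>v\<in>set R. v < t"
    and L_R: "\<forall>v\<in>set L. \<forall>w\<in>set R. v < w"
  assumes "a \<le> b" "set X \<subseteq> {a..b}" "avoids X perm231" "avoids X (L @ t # R)"
  shows "serves (add_mset b (replicate_mset (2 * length L + 2 * length R + 1) a)) X
    (replicate_mset (2 * length L + 2 * length R + 2) b)
    ((4 * length L + 4 * length R + 3) * (b - a))"
  using assms(6-)
proof (induction "length X" arbitrary: a b X rule: less_induct)
  case less
  let ?l = "length L" and ?r = "length R"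
  have left: "serves (replicate_mset (2 * ?l) a) P (replicate_mset (2 * ?l) c) (4 * ?l * (c - a))"
    if "a \<le> c" "set P \<subseteq> {a..c}" "subseq P X" "P = [] \<or> avoids P L" for P and c :: real
  proof (cases "P = []")
    case True
    have "real (2 * ?l) * \<bar>a - c\<bar> \<le> 4 * ?l * (c - a)"
      using that(1) by (simp add: mult_right_mono)
    then show ?thesis using serves_mono[OF serves_shift] True by blast
  next
    case False
    moreover have "avoids P perm231" using that(3) less.prems(3) contains_subseq by blast
    ultimately show ?thesis using servableD[OF L that(1,2)] that(4) by blast
  qed
  \<comment> \<open>While the servers for \<open>L\<close> serve \<open>P\<close>, the server at
    \<open>z\<close> stays put; afterwards the other \<open>2 * ?r + 1\<close> servers catch up at
    \<open>c\<close>.\<close>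
  have sweep: "serves (add_mset z (replicate_mset (2 * ?l + 2 * ?r + 1) a)) P
      (add_mset z (replicate_mset (2 * ?l + 2 * ?r + 1) c)) ((4 * ?l + 2 * ?r + 1) * (c - a))"
    if "a \<le> c" "set P \<subseteq> {a..c}" "subseq P X" "P = [] \<or> avoids P L" for P and c z :: real
  proof -
    have "serves (replicate_mset (2 * ?l) a + replicate_mset (2 * ?r + 1) a) P
        (replicate_mset (2 * ?l) c + replicate_mset (2 * ?r + 1) c)
        (4 * ?l * (c - a) + real (2 * ?r + 1) * \<bar>a - c\<bar>)"
      by (rule serves_parallel[OF left[OF that] serves_shift])
    from serves_frame[OF this, of "{#z#}"] show ?thesis using that(1)
      by (simp add: replicate_mset_add[symmetric] algebra_simps add_mset_commute)
  qed
  show ?case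
  proof (cases "X = [] \<or> avoids X L")
    case True
    have "real (4 * ?l + 2 * ?r + 1) * (b - a) \<le> (4 * ?l + 4 * ?r + 3) * (b - a)"
      using less.prems(1) by (intro mult_right_mono) auto
    moreover have "add_mset b (replicate_mset (2 * ?l + 2 * ?r + 1) b) =
        replicate_mset (2 * ?l + 2 * ?r + 2) b" by simp
    ultimately show ?thesis
      using serves_mono[OF sweep[of b X b]] True less.prems(1,2) by (metis subseq_order.refl)
  next
    case False
    have "\<exists>P c m B Q. [] @ X = P @ m # B @ Q \<and> set P \<subseteq> {a..c} \<and> set B \<subseteq> {c..m} \<and>
        set Q \<subseteq> {m..b} \<and> a \<le> c \<and> c \<le> m \<and> m \<le> b \<and> (P = [] \<or> avoids P L) \<and>
        contains (P @ m # B) L"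
      using False less.prems by (intro split_at_completion[where c = a]) auto
    then obtain P c m B Q where
      "[] @ X = P @ m # B @ Q" and P: "set P \<subseteq> {a..c}" "P = [] \<or> avoids P L"
      and B: "set B \<subseteq> {c..m}" and Q: "set Q \<subseteq> {m..b}"
      and le: "a \<le> c" "c \<le> m" "m \<le> b" and cont: "contains (P @ m # B) L"
      by blast
    then have X: "X = P @ m # B @ Q" by simp
    have sub: "subseq P X" "subseq B X" "subseq Q X"
      unfolding X by (auto intro: list_emb_prefix list_emb_append2)
    have 1: "serves (add_mset b (replicate_mset (2 * ?l + 2 * ?r + 1) a)) P
      (add_mset b (replicate_mset (2 * ?l + 2 * ?r + 1) c)) ((4 * ?l + 2 * ?r + 1) * (c - a))"
      by (rule sweep[OF le(1) P(1) sub(1) P(2)])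
    \<comment> \<open>The induction hypothesis for the block interior on \<open>{c..m}\<close> needs
      a server at \<open>m\<close>: it is the one from \<open>b\<close>, which descends to
      \<open>m\<close> and serves the block maximum on arrival.\<close>
    have "serves (add_mset m (replicate_mset (2 * ?l + 2 * ?r + 1) c)) B
      (replicate_mset (2 * ?l + 2 * ?r + 2) m) ((4 * ?l + 4 * ?r + 3) * (m - c))"
      using sub(2) less.prems(3,4) X B le contains_subseq by (intro less.hyps) auto
    then have 2: "serves (add_mset b (replicate_mset (2 * ?l + 2 * ?r + 1) c)) (m # B)
      (replicate_mset (2 * ?l + 2 * ?r + 2) m) (\<bar>b - m\<bar> + (4 * ?l + 4 * ?r + 3) * (m - c))"
      by (intro serves.move serves.serve)
    have "serves (replicate_mset (2 * ?r + 2) m) Q (replicate_mset (2 * ?r + 2) b)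
      ((4 * ?r + 2) * (b - m))"
    proof (rule serves_right_blocks[OF R Q le(3)])
      show "avoids Q perm231" using sub(3) less.prems(3) contains_subseq by blast
      fix z Z assume Z: "subseq (z # Z) Q" "order_isomorphic Z R" "m < z" "\<forall>v\<in>set Z. m < v \<and> v < z"
      obtain W where W: "subseq W (P @ m # B)" "order_isomorphic W L"
        using cont unfolding contains_def by blast
      have Wm: "v \<le> m" if "v \<in> set W" for v
      proof -
        have "v \<in> set (P @ m # B)" using list_emb_set[OF W(1) that] by blast
        then show ?thesis using P B le by auto
      qed
      \<comment> \<open>The copy \<open>W\<close> of \<open>L\<close> lies weakly below
        \<open>m\<close> and \<open>z # Z\<close> strictly above it, so together they would form a
        forbidden copy of the whole pattern.\<close>
      have "order_isomorphic (W @ z # Z) (L @ t # R)"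
      proof (rule order_isomorphic_append)
        show "order_isomorphic (z # Z) (t # R)"
          using Z(2,4) R_lt by (intro order_isomorphic_Cons_max) auto
        show "v < w" if "v \<in> set W" "w \<in> set (z # Z)" for v w
          using Wm[OF that(1)] that(2) Z(3,4) by auto
        show "v < w" if "v \<in> set L" "w \<in> set (t # R)" for v w
          using that L_lt L_R by auto
      qed (rule W(2))
      moreover have "subseq (W @ z # Z) ((P @ m # B) @ Q)"
        using W(1) Z(1) by (rule list_emb_append_mono)
      ultimately show False using less.prems(4) X unfolding contains_def by auto
    qed
    from serves_parallel[OF this serves_shift[of "2 * ?l" m b]]
    have 3: "serves (replicate_mset (2 * ?l + 2 * ?r + 2) m) Q
      (replicate_mset (2 * ?l + 2 * ?r + 2) b) ((4 * ?r + 2) * (b - m) + real (2 * ?l) * \<bar>m - b\<bar>)"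
      by (simp add: replicate_mset_add[symmetric] algebra_simps)
    \<comment> \<open>The pieces from \<open>a\<close> to \<open>c\<close>, \<open>c\<close> to
      \<open>m\<close> and \<open>m\<close> to \<open>b\<close> have total length
      \<open>b - a\<close>, and none costs more than \<open>4 * ?l + 4 * ?r + 3\<close> per unit
      length.\<close>
    have "(4 * ?l + 2 * ?r + 1) * (c - a) + (\<bar>b - m\<bar> + (4 * ?l + 4 * ?r + 3) * (m - c)) +
        ((4 * ?r + 2) * (b - m) + real (2 * ?l) * \<bar>m - b\<bar>)
      = (4 * real ?l + 2 * ?r + 1) * (c - a) + (4 * ?l + 4 * ?r + 3) * (m - c) +
        (2 * ?l + 4 * ?r + 3) * (b - m)"
      using le by (simp add: algebra_simps)
    also have "\<dots> \<le> (4 * ?l + 4 * ?r + 3) * (c - a) + (4 * ?l + 4 * ?r + 3) * (m - c) +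
        (4 * ?l + 4 * ?r + 3) * (b - m)"
      using le by (intro add_mono mult_right_mono) auto
    also have "\<dots> = (4 * ?l + 4 * ?r + 3) * (b - a)"
      by (simp add: algebra_simps)
    finally show ?thesis
      using serves_append[OF serves_append[OF 1 2] 3] X by (auto elim!: serves_mono)
  qed
qed

text \<open>Strong induction on the length, since \<open>L\<close> and \<open>R\<close> are shorter
  and inherit 231-avoidance. One server is first sent from \<open>a\<close> to \<open>b\<close>, as
  \<open>serves_nested\<close> requires; this trip raises the factor
  \<open>4 * length L + 4 * length R + 3\<close> to \<open>4 * length \<pi>\<close>.\<close>

lemma servable_avoiding_231:
  fixes \<pi> :: "nat list"
  assumes "distinct \<pi>" "avoids \<pi> perm231"
  shows "servable \<pi>"
  using assms
proof (induction "length \<pi>" arbitrary: \<pi> rule: less_induct)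
  case less
  show ?case
  proof (cases "\<pi> = []")
    case True
    then show ?thesis by (simp add: servable_def)
  next
    case False
    from split_max[OF this less.prems] obtain L t R where p: "\<pi> = L @ t # R"
      and lt: "\<forall>v\<in>set L. v < t" "\<forall>v\<in>set R. v < t" "\<forall>v\<in>set L. \<forall>w\<in>set R. v < w" .
    have "subseq L \<pi>" "subseq R \<pi>" unfolding p by (auto intro: list_emb_prefix list_emb_append2)
    then have "avoids L perm231" "avoids R perm231" using less.prems(2) contains_subseq by blast+
    then have "servable L" "servable R" using less.prems(1) p by (auto intro!: less.hyps)
    note nested = serves_nested[OF this lt]
    show ?thesis unfolding servable_def
    proof (intro allI impI)
      fix a b :: real and X :: "real list"
      assume ab: "a \<le> b" and X: "set X \<subseteq> {a..b}" "avoids X perm231" "avoids X \<pi>"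
      have len: "2 * length \<pi> = Suc (2 * length L + 2 * length R + 1)"
        "2 * length \<pi> = 2 * length L + 2 * length R + 2" by (simp_all add: p)
      have cost: "\<bar>a - b\<bar> + real (4 * length L + 4 * length R + 3) * (b - a) = 4 * length \<pi> * (b - a)"
        using ab by (simp add: p algebra_simps)
      from serves.move[OF nested[OF ab X(1,2) X(3)[unfolded p]], of a]
      show "serves (replicate_mset (2 * length \<pi>) a) X (replicate_mset (2 * length \<pi>) b)
          (real (4 * length \<pi>) * (b - a))"
        unfolding cost len(2)[symmetric] replicate_mset_Suc[symmetric] len(1)[symmetric] .
    qed
  qed
qed

theorem theorem3p9:
  fixes \<pi> :: "nat list" and k n :: nat and X :: "real list"
  assumes "\<pi> \<in> permutations_of_set {1..length \<pi>}"
    and "avoids \<pi> perm231"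
    and "k = 2 ^ (length \<pi> + 1)"
    and "length X = n" and "set X \<subseteq> {0..1}"
    and "avoids X perm231" and "avoids X \<pi>"
  shows "OPT k X \<le> 2 ^ (length \<pi> + 2)"
proof -
  let ?m = "length \<pi>"
  \<comment> \<open>This gives both \<open>2 * ?m \<le> k\<close>, with the surplus servers idle at
    0, and the comparison of \<open>4 * ?m\<close> with the claimed bound.\<close>
  have m: "?m < 2 ^ ?m" by (rule less_exp)
  have "distinct \<pi>" using assms(1) by (simp add: permutations_of_set_def)
  from servableD[OF servable_avoiding_231[OF this assms(2)], of 0 1 X] assms(5-7)
  have "serves (replicate_mset (2 * ?m) 0) X (replicate_mset (2 * ?m) 1) (4 * ?m)" by simp
  from serves_frame[OF this, of "replicate_mset (k - 2 * ?m) 0"]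
  have "serves (replicate_mset k 0) X
      (replicate_mset (2 * ?m) 1 + replicate_mset (k - 2 * ?m) 0) (4 * ?m)"
    using m assms(3) by (simp add: replicate_mset_add[symmetric])
  from OPT_le_serves[OF this assms(5)] have "OPT k X \<le> 4 * ?m" .
  also have "real (4 * ?m) \<le> real (4 * 2 ^ ?m)" using m by (intro of_nat_mono) simp
  finally show ?thesis by (simp add: power_add)
qed

end
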